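(* Let $n,k\ge 1$ and let $V\subset\mathbb{R}^n$ be the tropical prevariety given by $k$ tropical polynomials in $n$ variables with tropical degrees at most $d$, where infinite coefficients are allowed. Then the number of connected components of $V$ is not greater than $$\frac{d^{3n}}{k+n+1}\binom{k+7n-1}{3n}.$$
   Context: A tropical polynomial $f$ in $n$ variables is given by a nonempty finite set of tropical monomials $Q_j(x)=a_j+i_{j1}x_1+\cdots+i_{jn}x_n$ with $a_j\in\mathbb{R}$ and pairwise distinct exponent vectors $(i_{j1},\dots,i_{jn})\in\mathbb{Z}_{\ge 0}^n$; $f(x)=\min_j Q_j(x)$. The tropical degree of $Q_j$ is $i_{j1}+\cdots+i_{jn}$, and the tropical degree of $f$ is the maximum of the degrees of its monomials. A monomial not occurring in $f$ is said to have coefficient $\infty$; "infinite coefficients are allowed" means that any monomials may be missing from the polynomials. A point $x\in\mathbb{R}^n$ is a tropical zero of $f$ if $\min_j Q_j(x)$ is attained for at least two different values of $j$. The tropical prevariety given by $f_1,\dots,f_k$ is the set of all $x\in\mathbb{R}^n$ that are tropical zeros of every $f_i$. *)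

theory Defs
  imports "HOL-Analysis.Analysis"
begin

text \<open>
  A tropical polynomial in variables indexed by the finite type \<open>'n\<close> is the partial map sending the
  exponent vector of each occurring monomial to its coefficient; \<open>None\<close> is the coefficient
  \<open>\<infinity>\<close>. Distinctness of the exponent vectors is thereby built in.
\<close>

type_synonym 'n trop_poly = "(nat ^ 'n) \<Rightarrow> real option"

definition trop_poly :: "'n::finite trop_poly \<Rightarrow> bool" where
  "trop_poly f \<longleftrightarrow> finite (dom f) \<and> dom f \<noteq> {}"

definition trop_monomial :: "real \<Rightarrow> nat ^ 'n::finite \<Rightarrow> real ^ 'n \<Rightarrow> real" where
  "trop_monomial a e x = a + (\<Sum>i\<in>UNIV. real (e $ i) * x $ i)"

definition trop_eval :: "'n::finite trop_poly \<Rightarrow> real ^ 'n \<Rightarrow> real" where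
  "trop_eval f x = Min ((\<lambda>e. trop_monomial (the (f e)) e x) ` dom f)"

definition trop_monomial_degree :: "nat ^ 'n::finite \<Rightarrow> nat" where
  "trop_monomial_degree e = (\<Sum>i\<in>UNIV. e $ i)"

definition trop_degree :: "'n::finite trop_poly \<Rightarrow> nat" where
  "trop_degree f = Max (trop_monomial_degree ` dom f)"

definition trop_zero :: "'n::finite trop_poly \<Rightarrow> real ^ 'n \<Rightarrow> bool" where
  "trop_zero f x \<longleftrightarrow>
     (\<exists>e\<in>dom f. \<exists>e'\<in>dom f. e \<noteq> e' \<and>
        trop_monomial (the (f e)) e x = trop_eval f x \<and>
        trop_monomial (the (f e')) e' x = trop_eval f x)"

definition trop_prevariety :: "nat \<Rightarrow> (nat \<Rightarrow> 'n::finite trop_poly) \<Rightarrow> (real ^ 'n) set" where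
  "trop_prevariety k f = {x. \<forall>i<k. trop_zero (f i) x}"

end

theory Submission imports Defs "HOL-Library.Multiset" begin

text \<open>
  Let \<open>n\<close> be the number of variables and adjoin to the given \<open>k\<close> polynomials the \<open>n\<close> coordinate
  polynomials \<open>min 0 x\<^sub>j\<close>. A point is a vertex if the differences of exponents of simultaneously
  minimal monomials, taken over all \<open>k + n\<close> polynomials, span the space. Every component of the
  prevariety contains a vertex: at any other point one can move orthogonally to these differences;
  all ties survive, so the point stays in its component, and because of the coordinate polynomials a
  new tie occurs sooner or later in one of the two directions
  (\<open>edges_increase_along_segment\<close>, \<open>component_contains_vertex\<close>).
  It remains to count the vertices.

  At a vertex \<open>v\<close>, choose a basis of the space among the differences. Recording which polynomial each
  basis vector comes from gives a multiset \<open>M\<close> of \<open>n\<close> indices. Let \<open>G\<close> be the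
  sum of the polynomial functions in \<open>M\<close>, a concave function. If the \<open>j\<close>-th basis vector is
  \<open>p\<^sub>j - q\<^sub>j\<close>, all points \<open>\<Sum>\<^sub>j (1 - t\<^sub>j) q\<^sub>j + t\<^sub>j p\<^sub>j\<close> with \<open>0 \<le> t\<^sub>j \<le> 1\<close>
  are supergradients of \<open>G\<close> at \<open>v\<close>. They form a nondegenerate parallelepiped with integral vertices,
  inside the simplex of nonnegative vectors with coordinate sum at most \<open>n d\<close>. The parallelepiped
  lies in the cell dual to \<open>v\<close> of the Newton subdivision of \<open>G\<close>, and cells of different vertices
  overlap only in hyperplanes. Its integer translates cover the space, so it contains a point of
  \<open>\<epsilon> + \<int>\<^sup>n\<close> for every \<open>\<epsilon>\<close>; for generic \<open>\<epsilon>\<close> in the unit cube these points are distinct for distinct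
  vertices, and the simplex contains at most \<open>(n d + n - 1) choose n\<close> of them
  (\<open>card_le_by_disjoint_superdifferentials\<close>). This replaces the comparison of volumes
  in the usual proof of Bezout-type bounds.

  There are \<open>(k + 2 n - 1) choose n\<close> multisets \<open>M\<close>, so the number of components is at most
  \<open>((k + 2 n - 1) choose n) * ((n d + n - 1) choose n)\<close>. Elementary estimates of binomial
  coefficients show that the stated bound is weaker.
\<close>

section \<open>Active monomials and edge directions\<close>

definition exponent_vec :: "nat ^ 'n::finite \<Rightarrow> real ^ 'n" where
  "exponent_vec e = (\<chi> i. real (e $ i))"

definition active :: "'n::finite trop_poly \<Rightarrow> real ^ 'n \<Rightarrow> (nat ^ 'n) set" where
  "active f x = {e \<in> dom f. trop_monomial (the (f e)) e x = trop_eval f x}"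

text \<open>
  The span of this set is the sum of the direction spaces of the cells dual to \<open>x\<close> in the Newton
  subdivisions of the \<open>g i\<close>. It is the whole space exactly if \<open>x\<close> is a vertex of the common refinement of the
  domains of linearity.
\<close>

definition edges :: "('i \<Rightarrow> 'n::finite trop_poly) \<Rightarrow> 'i set \<Rightarrow> real ^ 'n \<Rightarrow> (real ^ 'n) set" where
  "edges g I x = (\<Union>i\<in>I. {exponent_vec p - exponent_vec q | p q.
     p \<in> active (g i) x \<and> q \<in> active (g i) x})"

lemma trop_monomial_affine:
  "trop_monomial a e y = trop_monomial a e x + exponent_vec e \<bullet> (y - x)"
  by (simp add: trop_monomial_def exponent_vec_def inner_vec_def sum_subtractf algebra_simps)

lemma trop_eval_le:
  assumes "trop_poly f" "e \<in> dom f"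
  shows "trop_eval f x \<le> trop_monomial (the (f e)) e x"
  using assms unfolding trop_eval_def trop_poly_def by (intro Min_le) auto

lemma trop_eval_supergradient:
  assumes "trop_poly f" "e \<in> active f v"
  shows "trop_eval f x \<le> trop_eval f v + exponent_vec e \<bullet> (x - v)"
  using assms trop_eval_le[of f e x] trop_monomial_affine[of "the (f e)" e x v]
  by (auto simp: active_def)

lemma active_nonempty:
  assumes "trop_poly f"
  shows "active f x \<noteq> {}"
proof -
  have "trop_eval f x \<in> (\<lambda>e. trop_monomial (the (f e)) e x) ` dom f"
    using assms unfolding trop_eval_def trop_poly_def by (intro Min_in) auto
  then show ?thesis by (auto simp: active_def)
qed

lemma activeI:
  assumes "trop_poly f" "e \<in> dom f"
    and "\<And>e'. e' \<in> dom f \<Longrightarrow> trop_monomial (the (f e)) e x \<le> trop_monomial (the (f e')) e' x"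
  shows "e \<in> active f x"
proof -
  obtain e' where "e' \<in> active f x" using active_nonempty[OF assms(1)] by blast
  then show ?thesis
    using assms(3)[of e'] trop_eval_le[OF assms(1,2), of x] assms(2) by (auto simp: active_def)
qed

lemma trop_zero_iff_active:
  "trop_zero f x \<longleftrightarrow> (\<exists>e\<in>active f x. \<exists>e'\<in>active f x. e \<noteq> e')"
  by (auto simp: trop_zero_def active_def)

lemma edges_mono:
  assumes "\<And>i. i \<in> I \<Longrightarrow> active (g i) x \<subseteq> active (g i) y"
  shows "edges g I x \<subseteq> edges g I y"
  using assms unfolding edges_def by blast

section \<open>Vertices in connected components\<close>

text \<open>
  Moving from \<open>v\<close> along a vector \<open>w\<close> orthogonal to all its edge directions shifts monomials that are
  tied at \<open>v\<close> by the same amount. They stay minimal until an inactive monomial of some \<open>g i\<close> with a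
  different slope catches up. The exponent difference
  contributed by that monomial is not orthogonal to \<open>w\<close>, so it enlarges the span. The hypothesis on
  \<open>w\<close> excludes lines on which all polynomials are affine, where no vertex could ever be reached.
\<close>

lemma edges_increase_along_segment:
  assumes fin: "finite I" and poly: "\<And>i. i \<in> I \<Longrightarrow> trop_poly (g i)"
    and full: "\<And>w. w \<noteq> 0 \<Longrightarrow> \<exists>i\<in>I. \<exists>p\<in>dom (g i). \<exists>q\<in>dom (g i).
                 (exponent_vec p - exponent_vec q) \<bullet> w \<noteq> 0"
    and not_full: "span (edges g I v) \<noteq> UNIV"
  obtains v' where "dim (edges g I v) < dim (edges g I v')"
    and "\<And>y i. y \<in> closed_segment v v' \<Longrightarrow> i \<in> I \<Longrightarrow> active (g i) v \<subseteq> active (g i) y"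
proof -
  obtain w where w0: "w \<noteq> 0" and w: "span (edges g I v) \<subseteq> {x. w \<bullet> x = 0}"
    using span_not_univ_subset_hyperplane[OF not_full] by blast
  have orth: "exponent_vec p \<bullet> w = exponent_vec q \<bullet> w"
    if "i \<in> I" "p \<in> active (g i) v" "q \<in> active (g i) v" for i p q
  proof -
    have "exponent_vec p - exponent_vec q \<in> edges g I v" using that unfolding edges_def by blast
    then have "w \<bullet> (exponent_vec p - exponent_vec q) = 0" using w span_superset by blast
    then show ?thesis by (simp add: inner_diff_right inner_commute)
  qed
  have "\<forall>i\<in>I. \<exists>e. e \<in> active (g i) v" using active_nonempty[OF poly] by blast
  then obtain r where r: "\<And>i. i \<in> I \<Longrightarrow> r i \<in> active (g i) v" by metis
  have rdom: "r i \<in> dom (g i)" if "i \<in> I" for i using r[OF that] by (simp add: active_def)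
  define slope where "slope = (\<lambda>(i, e). (exponent_vec e - exponent_vec (r i)) \<bullet> w)"
  define gap where "gap = (\<lambda>(i, e). trop_monomial (the (g i e)) e v - trop_eval (g i) v)"
  have gap: "gap (i, e) \<ge> 0" if "i \<in> I" "e \<in> dom (g i)" for i e
    using trop_eval_le[OF poly that(2)] that(1) by (simp add: gap_def)
  have along: "trop_monomial (the (g i e)) e (v + t *\<^sub>R w)
      = trop_monomial (the (g i (r i))) (r i) (v + t *\<^sub>R w) + gap (i, e) + t * slope (i, e)"
    if "i \<in> I" for i e t
    using r[OF that] trop_monomial_affine[of "the (g i e)" e "v + t *\<^sub>R w" v]
      trop_monomial_affine[of "the (g i (r i))" "r i" "v + t *\<^sub>R w" v]
    by (simp add: gap_def slope_def active_def algebra_simps)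
  define P where "P = {(i, e). i \<in> I \<and> e \<in> dom (g i) \<and> slope (i, e) \<noteq> 0}"
  have "P \<subseteq> Sigma I (\<lambda>i. dom (g i))" by (auto simp: P_def)
  moreover have "finite (Sigma I (\<lambda>i. dom (g i)))"
    using fin poly by (auto simp: trop_poly_def)
  ultimately have finP: "finite P" by (rule finite_subset)
  have "P \<noteq> {}"
  proof -
    obtain i p q where i: "i \<in> I" "p \<in> dom (g i)" "q \<in> dom (g i)"
      "(exponent_vec p - exponent_vec q) \<bullet> w \<noteq> 0" using full[OF w0] by blast
    then have "slope (i, p) \<noteq> 0 \<or> slope (i, q) \<noteq> 0"
      by (auto simp: slope_def inner_diff_left)
    then show ?thesis using i unfolding P_def by blast
  qed
  \<comment> \<open>Each pair in \<open>P\<close> reaches its tie at the parameter \<open>\<plusminus>\<tau>\<close>. Minimizing over both directions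
    at once picks the first tie, and no inactive monomial overtakes an active one before it.\<close>
  define \<tau> where "\<tau> = (\<lambda>z. gap z / \<bar>slope z\<bar>)"
  obtain i0 e0 where ie0: "(i0, e0) \<in> P" and min: "\<And>z. z \<in> P \<Longrightarrow> \<tau> (i0, e0) \<le> \<tau> z"
    using ex_is_arg_min_if_finite[OF finP \<open>P \<noteq> {}\<close>, of \<tau>] unfolding is_arg_min_def
    by (metis linorder_not_less surj_pair)
  define T where "T = - gap (i0, e0) / slope (i0, e0)"
  have slope0: "slope (i0, e0) \<noteq> 0" and i0: "i0 \<in> I" "e0 \<in> dom (g i0)"
    using ie0 by (auto simp: P_def)
  have absT: "\<bar>T\<bar> = \<tau> (i0, e0)" using gap[OF i0] by (simp add: T_def \<tau>_def)
  have above: "0 \<le> gap (i, e) + t * slope (i, e)"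
    if "i \<in> I" "e \<in> dom (g i)" "\<bar>t\<bar> \<le> \<bar>T\<bar>" for i e t
  proof (cases "slope (i, e) = 0")
    case True then show ?thesis using gap that by simp
  next
    case False
    then have "(i, e) \<in> P" using that by (simp add: P_def)
    then have "\<bar>t\<bar> \<le> gap (i, e) / \<bar>slope (i, e)\<bar>" using min that absT by (force simp: \<tau>_def)
    then have "\<bar>t * slope (i, e)\<bar> \<le> gap (i, e)"
      using False by (simp add: pos_le_divide_eq abs_mult)
    then show ?thesis by linarith
  qed
  have base_active: "r i \<in> active (g i) (v + t *\<^sub>R w)" if "i \<in> I" "\<bar>t\<bar> \<le> \<bar>T\<bar>" for i t
    using above[OF that(1) _ that(2)] along[OF that(1)]
    by (intro activeI[OF poly[OF that(1)] rdom[OF that(1)]]) (smt (verit))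
  have keep: "active (g i) v \<subseteq> active (g i) (v + t *\<^sub>R w)" if "i \<in> I" "\<bar>t\<bar> \<le> \<bar>T\<bar>" for i t
  proof
    fix e assume e: "e \<in> active (g i) v"
    then have "gap (i, e) = 0" "slope (i, e) = 0"
      using orth[OF that(1) e r[OF that(1)]] by (auto simp: gap_def slope_def active_def inner_diff_left)
    then show "e \<in> active (g i) (v + t *\<^sub>R w)"
      using e base_active[OF that] along[OF that(1), of e t] by (auto simp: active_def)
  qed
  define v' where "v' = v + T *\<^sub>R w"
  have "gap (i0, e0) + T * slope (i0, e0) = 0" using slope0 by (simp add: T_def)
  then have "e0 \<in> active (g i0) v'"
    using along[OF i0(1), of e0 T] base_active[OF i0(1), of T] i0(2) by (auto simp: active_def v'_def)
  then have new: "exponent_vec e0 - exponent_vec (r i0) \<in> edges g I v'"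
    using base_active[OF i0(1), of T] i0(1) unfolding edges_def v'_def by blast
  have "exponent_vec e0 - exponent_vec (r i0) \<notin> span (edges g I v)"
    using w slope0 by (auto simp: slope_def inner_commute)
  then have "dim (edges g I v) < dim (insert (exponent_vec e0 - exponent_vec (r i0)) (edges g I v))"
    by (simp add: dim_insert)
  also have "\<dots> \<le> dim (edges g I v')"
    using new edges_mono[of I g v v'] keep by (intro dim_subset) (auto simp: v'_def)
  finally have "dim (edges g I v) < dim (edges g I v')" .
  moreover have "active (g i) v \<subseteq> active (g i) y" if "y \<in> closed_segment v v'" "i \<in> I" for y i
  proof -
    obtain s where s: "0 \<le> s" "s \<le> 1" "y = (1 - s) *\<^sub>R v + s *\<^sub>R v'"
      using \<open>y \<in> closed_segment v v'\<close> by (auto simp: in_segment)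
    then have "y = v + (s * T) *\<^sub>R w" by (simp add: v'_def algebra_simps)
    moreover have "\<bar>s * T\<bar> \<le> \<bar>T\<bar>" using s by (simp add: abs_mult mult_left_le_one_le)
    ultimately show ?thesis using keep[OF \<open>i \<in> I\<close>] by simp
  qed
  ultimately show ?thesis using that by blast
qed

text \<open>
  A point of the component whose edge directions have maximal rank must be a vertex, since otherwise
  the rank grows along a segment that preserves all ties and hence stays in the component. The index
  set \<open>I\<close> may exceed the set \<open>J\<close> of defining polynomials; the extra ones serve only to cut the
  cells into pieces that have vertices.
\<close>

lemma component_contains_vertex:
  assumes fin: "finite I" and poly: "\<And>i. i \<in> I \<Longrightarrow> trop_poly (g i)" and "J \<subseteq> I"
    and full: "\<And>w. w \<noteq> 0 \<Longrightarrow> \<exists>i\<in>I. \<exists>p\<in>dom (g i). \<exists>q\<in>dom (g i).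
                 (exponent_vec p - exponent_vec q) \<bullet> w \<noteq> 0"
    and C: "C \<in> components {x. \<forall>i\<in>J. trop_zero (g i) x}"
  shows "\<exists>v\<in>C. span (edges g I v) = UNIV"
proof -
  obtain v0 where "v0 \<in> C" using C in_components_nonempty by blast
  then obtain v where v: "v \<in> C" and max: "\<And>y. y \<in> C \<Longrightarrow> dim (edges g I y) \<le> dim (edges g I v)"
    using ex_has_greatest_nat[of "\<lambda>y. y \<in> C" v0 "\<lambda>y. dim (edges g I y)" "Suc DIM(real^'b)"]
    by (metis dim_subset_UNIV le_imp_less_Suc)
  have "span (edges g I v) = UNIV"
  proof (rule ccontr)
    assume "span (edges g I v) \<noteq> UNIV"
    then obtain v' where v': "dim (edges g I v) < dim (edges g I v')"
      and seg: "\<And>y i. y \<in> closed_segment v v' \<Longrightarrow> i \<in> I \<Longrightarrow> active (g i) v \<subseteq> active (g i) y"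
      using edges_increase_along_segment[OF fin poly full] by blast
    have "trop_zero (g i) v" if "i \<in> J" for i using C v that in_components_subset by blast
    then have "closed_segment v v' \<subseteq> {x. \<forall>i\<in>J. trop_zero (g i) x}"
      using seg \<open>J \<subseteq> I\<close> unfolding trop_zero_iff_active by blast
    then have "closed_segment v v' \<subseteq> C"
      using v by (intro components_maximal[OF C]) auto
    then show False using max[of v'] v' by auto
  qed
  then show ?thesis using v by blast
qed

section \<open>Counting disjoint superdifferentials by shifted lattice points\<close>

text \<open>
  A slack variable, indexed by \<open>None\<close>, completes the vector to a multiset of size \<open>N - 1\<close> on
  one more index.
\<close>

lemma card_nat_vectors_sum_less:
  "finite {z :: nat ^ 'n::finite. (\<Sum>i\<in>UNIV. z $ i) < N}"
  "card {z :: nat ^ 'n. (\<Sum>i\<in>UNIV. z $ i) < N} \<le> (N + CARD('n) - 1) choose CARD('n)"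
proof -
  let ?Z = "{z :: nat ^ 'n. (\<Sum>i\<in>UNIV. z $ i) < N}"
  let ?M = "multisets_of_size (UNIV :: 'n option set) (N - 1)"
  have surj: "?Z \<subseteq> (\<lambda>M. \<chi> i. count M (Some i)) ` ?M"
  proof
    fix z :: "nat ^ 'n" assume "z \<in> ?Z"
    then have z: "(\<Sum>i\<in>UNIV. z $ i) < N" by simp
    define M where "M = (\<Sum>i\<in>UNIV. replicate_mset (z $ i) (Some i))
      + replicate_mset (N - 1 - (\<Sum>i\<in>UNIV. z $ i)) None"
    have "size M = N - 1" using z by (simp add: M_def size_multiset_sum)
    moreover have "count M (Some i) = z $ i" for i
      by (simp add: M_def count_sum if_distrib[of "count _"])
    ultimately show "z \<in> (\<lambda>M. \<chi> i. count M (Some i)) ` ?M"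
      by (intro image_eqI[of _ _ M]) (auto simp: multisets_of_size_def vec_eq_iff)
  qed
  have cardM: "card ?M = (CARD('n) + N - 1) choose (N - 1)" if "N > 0"
    using that by (simp add: card_multisets_of_size)
  have finM: "finite ?M"
    by (rule finite_multisets_of_size) simp
  show "finite ?Z" using surj finM by (meson finite_imageI finite_subset)
  show "card ?Z \<le> (N + CARD('n) - 1) choose CARD('n)"
  proof (cases "N = 0")
    case False
    have "card ?Z \<le> card ?M" using surj finM by (meson card_image_le card_mono finite_imageI le_trans)
    also have "\<dots> = (N + CARD('n) - 1) choose CARD('n)"
      using False binomial_symmetric[of "N - 1" "CARD('n) + N - 1"] cardM by (simp add: add.commute)
    finally show ?thesis .
  qed simp
qed

text \<open>
  The translates of the half-open parallelepiped by integer combinations of \<open>B\<close> cover the space, and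
  these combinations are integer vectors; one of the translates contains \<open>\<epsilon>\<close>. In coordinates:
  replace the coefficients of \<open>\<epsilon> - a\<close> with respect to \<open>B\<close> by their fractional parts.
\<close>

lemma parallelepiped_meets_shifted_lattice:
  fixes a \<epsilon> :: "real ^ 'n::finite"
  assumes fin: "finite B" and span: "span B = UNIV"
    and int: "\<And>b i. b \<in> B \<Longrightarrow> b $ i \<in> \<int>" "\<And>i. a $ i \<in> \<int>"
  obtains t where "\<And>b. 0 \<le> t b" "\<And>b. t b \<le> 1"
    and "\<And>i. (a + (\<Sum>b\<in>B. t b *\<^sub>R b) - \<epsilon>) $ i \<in> \<int>"
proof -
  have "\<epsilon> - a \<in> range (\<lambda>s. \<Sum>b\<in>B. s b *\<^sub>R b)" using span_finite[OF fin] span by auto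
  then obtain s where s: "\<epsilon> - a = (\<Sum>b\<in>B. s b *\<^sub>R b)" by auto
  have "a + (\<Sum>b\<in>B. frac (s b) *\<^sub>R b) - \<epsilon> = - (\<Sum>b\<in>B. of_int \<lfloor>s b\<rfloor> *\<^sub>R b)"
    using s by (simp add: frac_def algebra_simps sum_subtractf)
  moreover have "(- (\<Sum>b\<in>B. of_int \<lfloor>s b\<rfloor> *\<^sub>R b)) $ i \<in> \<int>" for i
    using int(1) by (auto intro!: Ints_sum Ints_mult)
  ultimately show ?thesis
    using frac_ge_0 frac_lt_1[THEN less_imp_le] by (intro that[of "\<lambda>b. frac (s b)"]) auto
qed

text \<open>
  If \<open>u\<close> is a supergradient of \<open>G\<close> at both \<open>v\<close> and \<open>w\<close>, the two inequalities force
  \<open>u \<bullet> (w - v) = G w - G v\<close>. Hence the superdifferentials of distinct points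
  meet only in a hyperplane. The finitely many hyperplanes, moved by the relevant integer vectors,
  do not fill the unit cube, and an \<open>\<epsilon>\<close> outside them makes the chosen points of \<open>\<epsilon> + \<int>\<^sup>n\<close> distinct.
  Subtracting \<open>\<epsilon>\<close> turns them into vectors of natural numbers of sum less than \<open>N\<close>. The inequality is
  strict because the coordinates of \<open>\<epsilon>\<close> are positive, which saves one unit in the binomial
  coefficient.
\<close>

lemma card_le_by_disjoint_superdifferentials:
  fixes G :: "real ^ 'n::finite \<Rightarrow> real"
  assumes fin: "finite W"
    and cell: "\<And>\<epsilon> v. v \<in> W \<Longrightarrow> \<exists>u. (\<forall>x. G x \<le> G v + u \<bullet> (x - v)) \<and> (\<forall>i. (u - \<epsilon>) $ i \<in> \<int>)
      \<and> (\<forall>i. 0 \<le> u $ i) \<and> (\<Sum>i\<in>UNIV. u $ i) \<le> real N"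
  shows "card W \<le> (N + CARD('n) - 1) choose CARD('n)"
proof -
  define Z where "Z = {z :: nat ^ 'n. (\<Sum>i\<in>UNIV. z $ i) < N}"
  have finZ: "finite Z" unfolding Z_def by (rule card_nat_vectors_sum_less)
  define H where "H = (\<lambda>(v, w, z). {\<epsilon>. (w - v) \<bullet> \<epsilon> = G w - G v - (w - v) \<bullet> exponent_vec z})"
  define D where "D = {(v, w). v \<in> W \<and> w \<in> W \<and> v \<noteq> w}"
  have "D \<subseteq> W \<times> W" by (auto simp: D_def)
  then have "finite D" using fin finite_subset by blast
  then have "negligible (\<Union>(v, w)\<in>D. \<Union>z\<in>Z. H (v, w, z))"
    using finZ by (intro negligible_Union finite_imageI)
      (auto simp: D_def H_def intro!: negligible_Union negligible_hyperplane)
  moreover have "\<not> negligible (box (0 :: real ^ 'n) (\<chi> i. 1))"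
    by (intro open_not_negligible) (auto simp: interval_ne_empty_cart)
  ultimately obtain \<epsilon> where box: "\<epsilon> \<in> box 0 (\<chi> i. 1)"
    and generic: "\<epsilon> \<notin> (\<Union>(v, w)\<in>D. \<Union>z\<in>Z. H (v, w, z))"
    by (meson negligible_subset subsetI)
  from box have eps: "0 < \<epsilon> $ i" "\<epsilon> $ i < 1" for i by (auto simp: mem_box_cart)
  have "\<exists>z\<in>Z. \<forall>x. G x \<le> G v + (exponent_vec z + \<epsilon>) \<bullet> (x - v)" if "v \<in> W" for v
  proof -
    obtain u where u: "\<And>x. G x \<le> G v + u \<bullet> (x - v)" "\<And>i. (u - \<epsilon>) $ i \<in> \<int>"
      "\<And>i. 0 \<le> u $ i" "(\<Sum>i\<in>UNIV. u $ i) \<le> real N" using cell[OF \<open>v \<in> W\<close>, of \<epsilon>] by blast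
    define z where "z = (\<chi> i. nat \<lfloor>(u - \<epsilon>) $ i\<rfloor>)"
    have z: "real (z $ i) = u $ i - \<epsilon> $ i" for i
    proof -
      obtain m where m: "u $ i - \<epsilon> $ i = of_int m" using u(2)[of i] by (auto elim: Ints_cases)
      have "of_int m > (-1 :: real)" using m u(3)[of i] eps(2)[of i] by linarith
      then have "m \<ge> 0" by simp
      then show ?thesis by (simp add: z_def m)
    qed
    then have uz: "u = exponent_vec z + \<epsilon>" by (simp add: exponent_vec_def vec_eq_iff)
    have "real (\<Sum>i\<in>UNIV. z $ i) = (\<Sum>i\<in>UNIV. u $ i) - (\<Sum>i\<in>UNIV. \<epsilon> $ i)"
      by (simp add: z sum_subtractf)
    also have "\<dots> < real N" using u(4) sum_pos[of UNIV "\<lambda>i. \<epsilon> $ i"] eps(1) by fastforce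
    finally have "z \<in> Z" unfolding Z_def by (simp only: of_nat_less_iff mem_Collect_eq)
    then show ?thesis using u(1) uz by blast
  qed
  then obtain h where h: "\<And>v. v \<in> W \<Longrightarrow> h v \<in> Z"
    "\<And>v x. v \<in> W \<Longrightarrow> G x \<le> G v + (exponent_vec (h v) + \<epsilon>) \<bullet> (x - v)" by metis
  have "inj_on h W"
  proof (rule inj_onI, rule ccontr)
    fix v w assume vw: "v \<in> W" "w \<in> W" "h v = h w" "v \<noteq> w"
    let ?u = "exponent_vec (h v) + \<epsilon>"
    have "G w \<le> G v + ?u \<bullet> (w - v)" "G v \<le> G w + ?u \<bullet> (v - w)"
      using h(2)[OF vw(1)] h(2)[OF vw(2)] vw(3) by auto
    then have "G w = G v + ?u \<bullet> (w - v)" by (simp add: inner_diff_right)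
    then have "\<epsilon> \<in> H (v, w, h v)" by (simp add: H_def inner_add_left inner_add_right inner_commute)
    then show False using generic vw h(1)[OF vw(1)] by (auto simp: D_def)
  qed
  then have "card W \<le> card Z" using h(1) finZ by (intro card_inj_on_le) auto
  then show ?thesis using card_nat_vectors_sum_less(2)[where 'n = 'n and N = N] unfolding Z_def by linarith
qed

section \<open>Counting vertices\<close>

text \<open>
  Each basis vector \<open>b\<close> is assigned a polynomial \<open>g (\<sigma> b)\<close> that contributes it. Only the multiset \<open>M\<close> of
  indices used is recorded, since it alone determines the function \<open>\<Sum>i\<in>#M. trop_eval (g i)\<close>
  whose superdifferentials are compared.
\<close>

definition resolves :: "('i \<Rightarrow> 'n::finite trop_poly) \<Rightarrow> 'i multiset \<Rightarrow> real ^ 'n \<Rightarrow> bool" where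
  "resolves g M v \<longleftrightarrow> (\<exists>B \<sigma>. independent B \<and> span B = UNIV \<and> M = image_mset \<sigma> (mset_set B) \<and>
     (\<forall>b\<in>B. b \<in> edges g {\<sigma> b} v))"

lemma vertex_resolved:
  fixes g :: "'i \<Rightarrow> 'n::finite trop_poly"
  assumes "span (edges g I v) = UNIV"
  shows "\<exists>M\<in>multisets_of_size I CARD('n). resolves g M v"
proof -
  obtain B where B: "B \<subseteq> edges g I v" "independent B" "edges g I v \<subseteq> span B"
    using maximal_independent_subset by blast
  then have spanB: "span B = UNIV" using assms span_minimal[OF B(3) subspace_span] by auto
  have finB: "finite B" and cardB: "card B = CARD('n)"
    using B(2) spanB independent_bound dim_eq_card_independent[OF B(2)] dim_span[of B] by auto
  have "\<forall>b\<in>B. \<exists>i\<in>I. b \<in> edges g {i} v" using B(1) by (fastforce simp: edges_def)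
  then obtain \<sigma> where \<sigma>: "\<And>b. b \<in> B \<Longrightarrow> \<sigma> b \<in> I \<and> b \<in> edges g {\<sigma> b} v" by metis
  show ?thesis
  proof
    show "resolves g (image_mset \<sigma> (mset_set B)) v"
      using B(2) spanB \<sigma> unfolding resolves_def by blast
    show "image_mset \<sigma> (mset_set B) \<in> multisets_of_size I CARD('n)"
      using finB cardB \<sigma> by (auto simp: multisets_of_size_def)
  qed
qed

lemma sum_exponent_vec_le:
  assumes "trop_poly f" "trop_degree f \<le> d" "e \<in> dom f"
  shows "(\<Sum>i\<in>UNIV. exponent_vec e $ i) \<le> real d"
proof -
  have "trop_monomial_degree e \<le> trop_degree f"
    using assms unfolding trop_degree_def trop_poly_def by (intro Max_ge) auto
  then have "real (\<Sum>i\<in>UNIV. e $ i) \<le> real d"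
    using assms(2) unfolding trop_monomial_degree_def by (intro of_nat_mono) simp
  then show ?thesis by (simp add: exponent_vec_def)
qed

text \<open>
  The convex combinations \<open>c b\<close> of the two exponents that \<open>b\<close> is the difference of are
  supergradients of the summand \<open>g (\<sigma> b)\<close>, and their sum over \<open>b\<close> is a supergradient of \<open>G\<close>. The
  coefficients can be chosen so that this sum lies in \<open>\<epsilon> + \<int>\<^sup>n\<close>.
\<close>

lemma card_resolved_le:
  fixes g :: "'i \<Rightarrow> 'n::finite trop_poly"
  assumes poly: "\<And>i. i \<in> I \<Longrightarrow> trop_poly (g i)" and deg: "\<And>i. i \<in> I \<Longrightarrow> trop_degree (g i) \<le> d"
    and M: "M \<in> multisets_of_size I CARD('n)"
  shows "finite {v. resolves g M v} \<and>
    card {v. resolves g M v} \<le> (CARD('n) * d + CARD('n) - 1) choose CARD('n)"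
proof (rule finite_if_finite_subsets_card_bdd)
  fix W assume W: "W \<subseteq> {v. resolves g M v}" "finite W"
  define G where "G = (\<lambda>x. \<Sum>i\<in>#M. trop_eval (g i) x)"
  show "card W \<le> (CARD('n) * d + CARD('n) - 1) choose CARD('n)"
  proof (rule card_le_by_disjoint_superdifferentials[OF W(2), of G])
    fix \<epsilon> v assume "v \<in> W"
    then obtain B \<sigma> where B: "independent B" "span B = UNIV" "M = image_mset \<sigma> (mset_set B)"
      "\<forall>b\<in>B. b \<in> edges g {\<sigma> b} v" using W(1) unfolding resolves_def by blast
    have fin: "finite B" using B(1) independent_bound by blast
    then have \<sigma>I: "\<sigma> b \<in> I" if "b \<in> B" for b using that M B(3) by (auto simp: multisets_of_size_def)
    have cardB: "card B = CARD('n)" using M B(3) by (auto simp: multisets_of_size_def)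
    have G: "G x = (\<Sum>b\<in>B. trop_eval (g (\<sigma> b)) x)" for x
      by (simp add: G_def B(3) sum_unfold_sum_mset image_mset.compositionality comp_def)
    have "\<forall>b\<in>B. \<exists>p q. p \<in> active (g (\<sigma> b)) v \<and> q \<in> active (g (\<sigma> b)) v
        \<and> b = exponent_vec p - exponent_vec q"
      using B(4) unfolding edges_def by blast
    then obtain p q where pq: "\<And>b. b \<in> B \<Longrightarrow> p b \<in> active (g (\<sigma> b)) v"
      "\<And>b. b \<in> B \<Longrightarrow> q b \<in> active (g (\<sigma> b)) v"
      "\<And>b. b \<in> B \<Longrightarrow> b = exponent_vec (p b) - exponent_vec (q b)" by metis
    define a where "a = (\<Sum>b\<in>B. exponent_vec (q b))"
    have "b $ i \<in> \<int>" if "b \<in> B" for b i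
      by (subst pq(3)[OF that]) (simp add: exponent_vec_def)
    moreover have "a $ i \<in> \<int>" for i by (auto simp: a_def exponent_vec_def intro!: Ints_sum)
    ultimately obtain t where t: "\<And>b. 0 \<le> t b" "\<And>b. t b \<le> 1"
      and lattice: "\<And>i. (a + (\<Sum>b\<in>B. t b *\<^sub>R b) - \<epsilon>) $ i \<in> \<int>"
      using parallelepiped_meets_shifted_lattice[OF fin B(2), of a \<epsilon>] by blast
    define c where "c = (\<lambda>b. (1 - t b) *\<^sub>R exponent_vec (q b) + t b *\<^sub>R exponent_vec (p b))"
    have "c b = exponent_vec (q b) + t b *\<^sub>R b" if "b \<in> B" for b
      by (subst (3) pq(3)[OF that]) (simp add: c_def algebra_simps)
    then have u: "(\<Sum>b\<in>B. c b) = a + (\<Sum>b\<in>B. t b *\<^sub>R b)" by (simp add: a_def sum.distrib)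
    have super: "trop_eval (g (\<sigma> b)) x \<le> trop_eval (g (\<sigma> b)) v + c b \<bullet> (x - v)" if "b \<in> B" for b x
    proof -
      let ?f = "g (\<sigma> b)"
      have "trop_eval ?f x - trop_eval ?f v \<le> exponent_vec e \<bullet> (x - v)" if "e \<in> active ?f v" for e
        using trop_eval_supergradient[OF poly[OF \<sigma>I[OF \<open>b \<in> B\<close>]] that] by (simp add: algebra_simps)
      then have "(1 - t b) * (trop_eval ?f x - trop_eval ?f v) + t b * (trop_eval ?f x - trop_eval ?f v)
          \<le> (1 - t b) * (exponent_vec (q b) \<bullet> (x - v)) + t b * (exponent_vec (p b) \<bullet> (x - v))"
        using pq(1,2)[OF that] t[of b] by (intro add_mono mult_left_mono) auto
      then show ?thesis by (simp add: c_def inner_left_distrib algebra_simps)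
    qed
    have "G x \<le> G v + (\<Sum>b\<in>B. c b) \<bullet> (x - v)" for x
      using sum_mono[OF super] by (simp add: G inner_sum_left sum.distrib)
    moreover have "0 \<le> (\<Sum>b\<in>B. c b) $ i" for i
      using t by (auto simp: c_def exponent_vec_def intro!: sum_nonneg)
    moreover have "(\<Sum>i\<in>UNIV. (\<Sum>b\<in>B. c b) $ i) \<le> real (CARD('n) * d)"
    proof -
      have "(\<Sum>i\<in>UNIV. c b $ i) \<le> real d" if "b \<in> B" for b
      proof -
        have le: "(\<Sum>i\<in>UNIV. exponent_vec e $ i) \<le> real d" if "e \<in> active (g (\<sigma> b)) v" for e
          using that \<sigma>I[OF \<open>b \<in> B\<close>] poly deg by (intro sum_exponent_vec_le) (auto simp: active_def)
        have "(\<Sum>i\<in>UNIV. c b $ i) = (1 - t b) * (\<Sum>i\<in>UNIV. exponent_vec (q b) $ i)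
            + t b * (\<Sum>i\<in>UNIV. exponent_vec (p b) $ i)"
          by (simp add: c_def sum.distrib sum_distrib_left)
        also have "\<dots> \<le> (1 - t b) * real d + t b * real d"
          using le pq(1,2)[OF that] t[of b] by (intro add_mono mult_left_mono) auto
        finally show ?thesis by (simp add: algebra_simps)
      qed
      then have "(\<Sum>b\<in>B. \<Sum>i\<in>UNIV. c b $ i) \<le> real (card B) * real d"
        by (rule sum_bounded_above)
      then show ?thesis using cardB by (simp add: sum.swap[of _ B])
    qed
    ultimately show "\<exists>u. (\<forall>x. G x \<le> G v + u \<bullet> (x - v)) \<and> (\<forall>i. (u - \<epsilon>) $ i \<in> \<int>)
      \<and> (\<forall>i. 0 \<le> u $ i) \<and> (\<Sum>i\<in>UNIV. u $ i) \<le> real (CARD('n) * d)"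
      using lattice unfolding u[symmetric] by blast
  qed
qed

lemma card_vertices_le:
  fixes g :: "'i \<Rightarrow> 'n::finite trop_poly"
  assumes "finite I" and poly: "\<And>i. i \<in> I \<Longrightarrow> trop_poly (g i)"
    and deg: "\<And>i. i \<in> I \<Longrightarrow> trop_degree (g i) \<le> d"
  shows "finite {v. span (edges g I v) = UNIV}"
    and "card {v. span (edges g I v) = UNIV} \<le> ((card I + CARD('n) - 1) choose CARD('n))
      * ((CARD('n) * d + CARD('n) - 1) choose CARD('n))"
proof -
  let ?\<M> = "multisets_of_size I CARD('n)"
  let ?b = "(CARD('n) * d + CARD('n) - 1) choose CARD('n)"
  have sub: "{v. span (edges g I v) = UNIV} \<subseteq> (\<Union>M\<in>?\<M>. {v. resolves g M v})"
    using vertex_resolved by blast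
  have fin\<M>: "finite ?\<M>" using \<open>finite I\<close> by (rule finite_multisets_of_size)
  have res: "finite {v. resolves g M v}" "card {v. resolves g M v} \<le> ?b" if "M \<in> ?\<M>" for M
    using card_resolved_le[OF poly deg that] by auto
  have fin: "finite (\<Union>M\<in>?\<M>. {v. resolves g M v})" using fin\<M> res(1) by blast
  then show "finite {v. span (edges g I v) = UNIV}" using sub finite_subset by blast
  have "card {v. span (edges g I v) = UNIV} \<le> card (\<Union>M\<in>?\<M>. {v. resolves g M v})"
    using sub fin by (rule card_mono[rotated])
  also have "\<dots> \<le> (\<Sum>M\<in>?\<M>. card {v. resolves g M v})" using fin\<M> by (rule card_UN_le)
  also have "\<dots> \<le> card ?\<M> * ?b" using res(2) by (rule sum_bounded_above[where 'a = nat, simplified])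
  finally show "card {v. span (edges g I v) = UNIV} \<le> ((card I + CARD('n) - 1) choose CARD('n)) * ?b"
    using \<open>finite I\<close> by (simp add: card_multisets_of_size)
qed

section \<open>Components of a prevariety\<close>

text \<open>
  The tropical polynomial \<open>min 0 x\<^sub>j\<close>, whose zero set is the hyperplane \<open>x\<^sub>j = 0\<close>.
\<close>

definition coordinate_poly :: "'n::finite \<Rightarrow> 'n trop_poly" where
  "coordinate_poly j = [0 \<mapsto> 0, axis j 1 \<mapsto> 0]"

lemma coordinate_poly:
  "trop_poly (coordinate_poly j)" "trop_degree (coordinate_poly j) = 1"
  "dom (coordinate_poly j) = {0, axis j 1}"
proof -
  show dom: "dom (coordinate_poly j) = {0, axis j 1}" by (auto simp: coordinate_poly_def)
  then show "trop_poly (coordinate_poly j)" by (simp add: trop_poly_def)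
  show "trop_degree (coordinate_poly j) = 1"
    by (simp add: trop_degree_def dom trop_monomial_degree_def axis_def)
qed

text \<open>
  The coordinate polynomials are adjoined so that vertices exist even if the Newton polytopes of the
  \<open>f i\<close> lie in translates of one proper subspace, where the prevariety is a union of parallel
  lines. Their degree is \<open>1 \<le> d\<close>, so the degree bound persists, and distinct components contain
  distinct vertices.
\<close>

lemma card_components_prevariety_le:
  fixes f :: "nat \<Rightarrow> 'n::finite trop_poly"
  assumes poly: "\<And>i. i < k \<Longrightarrow> trop_poly (f i)" and deg: "\<And>i. i < k \<Longrightarrow> trop_degree (f i) \<le> d"
    and "d \<ge> 1"
  shows "finite (components (trop_prevariety k f))"
    and "card (components (trop_prevariety k f)) \<le> ((k + 2 * CARD('n) - 1) choose CARD('n))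
      * ((CARD('n) * d + CARD('n) - 1) choose CARD('n))"
proof -
  define g where "g = case_sum f (coordinate_poly :: 'n \<Rightarrow> 'n trop_poly)"
  define I where "I = {..<k} <+> (UNIV :: 'n set)"
  let ?X = "{v. span (edges g I v) = UNIV}"
  have finI: "finite I" and cardI: "card I = k + CARD('n)" by (simp_all add: I_def card_Plus)
  have gI: "trop_poly (g i)" "trop_degree (g i) \<le> d" if "i \<in> I" for i
    using that poly deg \<open>d \<ge> 1\<close> by (auto simp: I_def g_def coordinate_poly)
  have full: "\<exists>i\<in>I. \<exists>p\<in>dom (g i). \<exists>q\<in>dom (g i). (exponent_vec p - exponent_vec q) \<bullet> w \<noteq> 0"
    if "w \<noteq> 0" for w
  proof -
    obtain j where "w $ j \<noteq> 0" using \<open>w \<noteq> 0\<close> by (auto simp: vec_eq_iff)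
    moreover have "exponent_vec (axis j 1) - exponent_vec 0 = axis j (1 :: real)"
      by (auto simp: exponent_vec_def vec_eq_iff axis_def)
    ultimately have "(exponent_vec (axis j 1) - exponent_vec 0) \<bullet> w \<noteq> 0" by (simp add: inner_axis')
    then show ?thesis
      by (intro bexI[of _ "Inr j"] bexI[of _ "axis j 1"] bexI[of _ 0])
        (auto simp: I_def g_def coordinate_poly)
  qed
  have V: "trop_prevariety k f = {x. \<forall>i\<in>Inl ` {..<k}. trop_zero (g i) x}"
    by (auto simp: trop_prevariety_def g_def)
  have "\<exists>v\<in>C. v \<in> ?X" if "C \<in> components (trop_prevariety k f)" for C
    using component_contains_vertex[OF finI gI(1) _ full, of "Inl ` {..<k}" C] that
    unfolding V by (auto simp: I_def)
  then obtain h where h: "\<And>C. C \<in> components (trop_prevariety k f) \<Longrightarrow> h C \<in> C \<and> h C \<in> ?X" by metis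
  then have inj: "inj_on h (components (trop_prevariety k f))"
    using components_nonoverlap by (metis (no_types, lifting) IntI empty_iff inj_onI)
  have img: "h ` components (trop_prevariety k f) \<subseteq> ?X" using h by blast
  have finX: "finite ?X" using finI gI by (rule card_vertices_le(1))
  show "finite (components (trop_prevariety k f))" using inj img finX by (rule inj_on_finite)
  have "card (components (trop_prevariety k f)) \<le> card ?X" using inj img finX by (rule card_inj_on_le)
  also have "\<dots> \<le> ((card I + CARD('n) - 1) choose CARD('n))
      * ((CARD('n) * d + CARD('n) - 1) choose CARD('n))"
    using finI gI by (rule card_vertices_le(2))
  finally show "card (components (trop_prevariety k f)) \<le> ((k + 2 * CARD('n) - 1) choose CARD('n))
      * ((CARD('n) * d + CARD('n) - 1) choose CARD('n))"
    by (simp add: cardI mult_2 add.assoc)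
qed

lemma trop_prevariety_degree_0:
  fixes f :: "nat \<Rightarrow> 'n::finite trop_poly"
  assumes "k \<ge> 1" "trop_poly (f 0)" "trop_degree (f 0) = 0"
  shows "trop_prevariety k f = {}"
proof -
  have zero: "e = 0" if "e \<in> dom (f 0)" for e
  proof -
    have "trop_monomial_degree e \<le> trop_degree (f 0)"
      using assms(2) that unfolding trop_degree_def trop_poly_def by (intro Max_ge) auto
    then show ?thesis using assms(3) by (simp add: trop_monomial_degree_def vec_eq_iff)
  qed
  have "\<not> trop_zero (f 0) x" for x using zero unfolding trop_zero_def by blast
  then show ?thesis using \<open>k \<ge> 1\<close> by (force simp: trop_prevariety_def)
qed

section \<open>Estimates of binomial coefficients\<close>

lemma binomial_mult_le_vandermonde: "(a choose p) * (b choose q) \<le> ((a + b) choose (p + q))"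
proof -
  have "(a choose p) * (b choose (p + q - p)) \<le> (\<Sum>k\<le>p + q. (a choose k) * (b choose (p + q - k)))"
    by (rule member_le_sum) auto
  then show ?thesis by (simp add: vandermonde)
qed

text \<open>
  Both binomial coefficients are rising factorials divided by \<open>n!\<close>, and \<open>n d + i \<le> d (n + i)\<close> for each
  factor.
\<close>

lemma multichoose_scale_le:
  assumes "d \<ge> 1" "n \<ge> 1"
  shows "(n * d + n - 1) choose n \<le> d ^ n * ((2 * n - 1) choose n)"
proof -
  have rising: "real ((N + n - 1) choose n) = (\<Prod>i<n. real (N + i)) / fact n" if "N \<ge> 1" for N
    using that \<open>n \<ge> 1\<close>
    by (simp add: binomial_gbinomial gbinomial_pochhammer' pochhammer_prod of_nat_diff lessThan_atLeast0)
  have "(\<Prod>i<n. real (n * d + i)) \<le> (\<Prod>i<n. real d * real (n + i))"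
  proof (intro prod_mono conjI)
    fix i
    have "n * d + i \<le> d * (n + i)" using \<open>d \<ge> 1\<close> by (simp add: algebra_simps)
    then show "real (n * d + i) \<le> real d * real (n + i)" by (metis of_nat_le_iff of_nat_mult)
  qed simp
  also have "\<dots> = real d ^ n * (\<Prod>i<n. real (n + i))" by (simp add: prod.distrib)
  finally have "real ((n * d + n - 1) choose n) \<le> real d ^ n * real ((n + n - 1) choose n)"
    using assms rising[of "n * d"] rising[of n] divide_right_mono[of _ _ "fact n :: real"] by simp
  then have "real ((n * d + n - 1) choose n) \<le> real (d ^ n * ((n + n - 1) choose n))" by simp
  then show ?thesis unfolding of_nat_le_iff by (simp add: mult_2)
qed

text \<open>
  Absorption turns \<open>3 n\<close> times the right-hand side into \<open>k + 7 n - 1\<close> times a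
  binomial coefficient; the first factor dominates \<open>k + n + 1\<close>, and the second is split by Vandermonde
  into a part with \<open>k\<close>, which is \<open>(k + 2 n - 1) choose n\<close>, and a part
  without \<open>k\<close>, which absorbs the remaining factors.
\<close>

lemma binomial_estimate:
  assumes "n \<ge> 1" "k \<ge> 1"
  shows "(k + n + 1) * ((k + 2 * n - 1) choose n) * ((2 * n - 1) choose n)
    \<le> (k + 7 * n - 1) choose (3 * n)"
proof -
  have A: "3 * n * ((2 * n - 1) choose n) \<le> (5 * n - 1) choose (2 * n - 1)"
    \<comment> \<open>The bound \<open>3 n \<le> 3 n choose (n - 1)\<close> used in general fails for \<open>n = 1\<close>.\<close>
  proof (cases "n = 1")
    case True
    then show ?thesis by (simp add: eval_nat_numeral)
  next
    case False
    have "((3 * n) choose 1) \<le> (3 * n) choose (n - 1)"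
      using False assms by (intro binomial_mono) auto
    then have "3 * n * ((2 * n - 1) choose n) \<le> ((2 * n - 1) choose n) * ((3 * n) choose (n - 1))"
      by simp
    also have "\<dots> \<le> (2 * n - 1 + 3 * n) choose (n + (n - 1))" by (rule binomial_mult_le_vandermonde)
    also have "\<dots> = (5 * n - 1) choose (2 * n - 1)" using assms by (intro arg_cong2[of _ _ _ _ "(choose)"]) auto
    finally show ?thesis .
  qed
  have "3 * n * ((k + n + 1) * ((k + 2 * n - 1) choose n) * ((2 * n - 1) choose n))
     = (k + n + 1) * (((k + 2 * n - 1) choose n) * (3 * n * ((2 * n - 1) choose n)))"
    by (simp only: ac_simps)
  also have "\<dots> \<le> (k + 7 * n - 1) * (((k + 2 * n - 1) choose n) * ((5 * n - 1) choose (2 * n - 1)))"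
    using A assms by (intro mult_le_mono) auto
  also have "\<dots> \<le> (k + 7 * n - 1) * ((k + 2 * n - 1 + (5 * n - 1)) choose (n + (2 * n - 1)))"
    by (intro mult_le_mono binomial_mult_le_vandermonde) simp
  also have "\<dots> = Suc (k + 7 * n - 2) * ((k + 7 * n - 2) choose (3 * n - 1))"
    using assms by (intro arg_cong2[of _ _ _ _ "(*)"] arg_cong2[of _ _ _ _ "(choose)"]) auto
  also have "\<dots> = Suc (3 * n - 1) * (Suc (k + 7 * n - 2) choose Suc (3 * n - 1))"
    by (rule Suc_times_binomial[symmetric])
  also have "\<dots> = 3 * n * ((k + 7 * n - 1) choose (3 * n))"
    using assms by (intro arg_cong2[of _ _ _ _ "(*)"] arg_cong2[of _ _ _ _ "(choose)"]) auto
  finally show ?thesis using assms by simp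
qed

section \<open>The bound on the number of components\<close>

theorem corollary9p3:
  fixes f :: "nat \<Rightarrow> 'n::finite trop_poly" and k d :: nat
  assumes "k \<ge> 1"
    and "\<And>i. i < k \<Longrightarrow> trop_poly (f i)"
    and "\<And>i. i < k \<Longrightarrow> trop_degree (f i) \<le> d"
  shows "finite (components (trop_prevariety k f)) \<and>
    real (card (components (trop_prevariety k f)))
      \<le> real d ^ (3 * CARD('n)) / real (k + CARD('n) + 1)
          * real ((k + 7 * CARD('n) - 1) choose (3 * CARD('n)))"
proof (cases "d = 0")
  case True
  then have "trop_prevariety k f = {}"
    using assms(2,3)[of 0] \<open>k \<ge> 1\<close> by (intro trop_prevariety_degree_0) auto
  then show ?thesis by simp
next
  case False
  let ?n = "CARD('n)" and ?c = "card (components (trop_prevariety k f))"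
  have d: "d \<ge> 1" using False by simp
  have n: "?n \<ge> 1" by (simp add: Suc_leI)
  have "(k + ?n + 1) * ?c
      \<le> (k + ?n + 1) * (((k + 2 * ?n - 1) choose ?n) * ((?n * d + ?n - 1) choose ?n))"
    using card_components_prevariety_le(2)[OF assms(2,3) d] by (intro mult_le_mono) auto
  also have "\<dots> \<le> (k + ?n + 1) * (((k + 2 * ?n - 1) choose ?n) * (d ^ ?n * ((2 * ?n - 1) choose ?n)))"
    using multichoose_scale_le[OF d n] by (intro mult_le_mono) auto
  also have "\<dots> = d ^ ?n * ((k + ?n + 1) * ((k + 2 * ?n - 1) choose ?n) * ((2 * ?n - 1) choose ?n))"
    by (simp only: ac_simps)
  also have "\<dots> \<le> d ^ (3 * ?n) * ((k + 7 * ?n - 1) choose (3 * ?n))"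
    using binomial_estimate[OF n \<open>k \<ge> 1\<close>] d by (intro mult_le_mono power_increasing) auto
  finally have "real ((k + ?n + 1) * ?c) \<le> real (d ^ (3 * ?n) * ((k + 7 * ?n - 1) choose (3 * ?n)))"
    by (rule of_nat_mono)
  then have "real ?c * real (k + ?n + 1) \<le> real d ^ (3 * ?n) * real ((k + 7 * ?n - 1) choose (3 * ?n))"
    by (simp only: of_nat_mult of_nat_power mult.commute[of "real ?c"])
  moreover have "0 < real (k + ?n + 1)" by simp
  ultimately have "real ?c \<le> real d ^ (3 * ?n) / real (k + ?n + 1) * real ((k + 7 * ?n - 1) choose (3 * ?n))"
    by (simp only: times_divide_eq_left pos_le_divide_eq)
  moreover have "finite (components (trop_prevariety k f))"
    using assms(2,3) d by (rule card_components_prevariety_le(1))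
  ultimately show ?thesis by blast
qed

end
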